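(* Let $n\geq2$ and let $M$ be any monoid. Then (i) $M\wr\mathrm{Sing}_n=\langle\mathcal X_n\rangle=\langle\mathcal X_2\rangle$; (ii) $\langle E(M\wr\mathrm{Sing}_n)\rangle=\langle\mathcal X_1\rangle=\{((a_1,\ldots,a_n),\alpha)\in M\wr\mathrm{Sing}_n : a_i\leq_{\mathscr L}a_j \text{ for some } (i,j)\in\ker(\alpha)\setminus\delta\}$, where $\delta=\{(i,i):1\le i\le n\}$; and (iii) $M\wr\mathrm{Sing}_n$ is idempotent-generated if and only if the partially ordered set $M/\mathscr L$ is a chain.
   Context: Maps are written on the right and composed from left to right. $\mathcal T_n$ is the monoid of all maps $\{1,\ldots,n\}\to\{1,\ldots,n\}$, and $\mathrm{Sing}_n$ is its subsemigroup of all non-bijective maps. For $\alpha\in\mathcal T_n$, $\ker(\alpha)=\{(i,j):i\alpha=j\alpha\}$. For a subsemigroup $S\subseteq\mathcal T_n$, the wreath product $M\wr S$ is the set $M^n\times S$ with product $$((a_1,\ldots,a_n),\alpha)((b_1,\ldots,b_n),\beta)=((a_1b_{1\alpha},\ldots,a_nb_{n\alpha}),\alpha\beta).$$ For distinct $i,j\in\{1,\ldots,n\}$, $\varepsilon_{ij}\in\mathrm{Sing}_n$ is the map with $j\varepsilon_{ij}=i$ and $k\varepsilon_{ij}=k$ for $k\neq j$. For $\mathbf a\in M^n$ put $\varepsilon_{ij;\mathbf a}=(\mathbf a,\varepsilon_{ij})$. For $a,b\in M$ put $\varepsilon_{ij;ab}=\varepsilon_{ij;\mathbf a}$, where $\mathbf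 a=(a_1,\ldots,a_n)$ has $a_i=a$, $a_j=b$ and $a_k=1$ for $k\notin\{i,j\}$ (here $a,b$ are two separate subscripts), and put $\varepsilon_{ij;a}=\varepsilon_{ij;1a}$ (so $a$ is in coordinate $j$ and all other coordinates are $1$). Define $\mathcal X_n=\{\varepsilon_{ij;\mathbf a}: i\neq j,\ \mathbf a\in M^n\}$, $\mathcal X_2=\{\varepsilon_{ij;ab}: i\neq j,\ a,b\in M\}$, $\mathcal X_1=\{\varepsilon_{ij;a}: i\neq j,\ a\in M\}$. For a subset $A$ of a semigroup, $\langle A\rangle$ is the subsemigroup generated by $A$ and $E(A)$ is the set of idempotents in $A$. On $M$, $a\leq_{\mathscr L}b$ means $a\in Mb$; $\mathscr L$ is the equivalence $\leq_{\mathscr L}\cap\geq_{\mathscr L}$, and $M/\mathscr L$ is the set of $\mathscr L$-classes with the partial order induced by $\leq_{\mathscr L}$. *)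

theory Defs
  imports "HOL-Algebra.Coset"
begin

text \<open>The generated subsemigroup depends only on the product, so no carrier is needed.\<close>

inductive_set generated_subsemigroup :: "('s \<Rightarrow> 's \<Rightarrow> 's) \<Rightarrow> 's set \<Rightarrow> 's set"
  for f :: "'s \<Rightarrow> 's \<Rightarrow> 's" and A :: "'s set"
  where
    incl: "x \<in> A \<Longrightarrow> x \<in> generated_subsemigroup f A"
  | prod: "x \<in> generated_subsemigroup f A \<Longrightarrow> y \<in> generated_subsemigroup f A \<Longrightarrow>
      f x y \<in> generated_subsemigroup f A"

definition idempotents :: "('s \<Rightarrow> 's \<Rightarrow> 's) \<Rightarrow> 's set \<Rightarrow> 's set" where
  "idempotents f A = {x \<in> A. f x x = x}"

definition idempotent_generated :: "('s \<Rightarrow> 's \<Rightarrow> 's) \<Rightarrow> 's set \<Rightarrow> bool" where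
  "idempotent_generated f S \<longleftrightarrow> generated_subsemigroup f (idempotents f S) = S"


text \<open>
  Maps on \<open>{1..n}\<close> and \<open>n\<close>-tuples are extensional functions on \<open>{1..n}\<close>.  Maps act on the
  right and are composed from left to right: \<open>i\<alpha>\<close> is \<open>\<alpha> i\<close>, and \<open>\<alpha>\<beta>\<close> is
  \<open>compose {1..n} \<beta> \<alpha>\<close>, which sends \<open>i\<close> to \<open>\<beta> (\<alpha> i)\<close>.
\<close>

definition full_transformations :: "nat \<Rightarrow> (nat \<Rightarrow> nat) set" where
  "full_transformations n = {1..n} \<rightarrow>\<^sub>E {1..n}"

definition Sing :: "nat \<Rightarrow> (nat \<Rightarrow> nat) set" where
  "Sing n = {\<alpha> \<in> full_transformations n. \<not> bij_betw \<alpha> {1..n} {1..n}}"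

definition map_ker :: "nat \<Rightarrow> (nat \<Rightarrow> nat) \<Rightarrow> (nat \<times> nat) set" where
  "map_ker n \<alpha> = {(i, j). i \<in> {1..n} \<and> j \<in> {1..n} \<and> \<alpha> i = \<alpha> j}"

definition tuples :: "('a, 'b) monoid_scheme \<Rightarrow> nat \<Rightarrow> (nat \<Rightarrow> 'a) set" where
  "tuples M n = {1..n} \<rightarrow>\<^sub>E carrier M"

definition wreath :: "('a, 'b) monoid_scheme \<Rightarrow> nat \<Rightarrow> (nat \<Rightarrow> nat) set \<Rightarrow>
    ((nat \<Rightarrow> 'a) \<times> (nat \<Rightarrow> nat)) set" where
  "wreath M n S = tuples M n \<times> S"

definition wreath_mult :: "('a, 'b) monoid_scheme \<Rightarrow> nat \<Rightarrow>
    (nat \<Rightarrow> 'a) \<times> (nat \<Rightarrow> nat) \<Rightarrow> (nat \<Rightarrow> 'a) \<times> (nat \<Rightarrow> nat) \<Rightarrow>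
    (nat \<Rightarrow> 'a) \<times> (nat \<Rightarrow> nat)" where
  "wreath_mult M n = (\<lambda>(a, \<alpha>) (b, \<beta>).
     (\<lambda>i\<in>{1..n}. a i \<otimes>\<^bsub>M\<^esub> b (\<alpha> i), compose {1..n} \<beta> \<alpha>))"


definition eps :: "nat \<Rightarrow> nat \<Rightarrow> nat \<Rightarrow> nat \<Rightarrow> nat" where
  "eps n i j = (\<lambda>k\<in>{1..n}. if k = j then i else k)"

definition eps2 :: "('a, 'b) monoid_scheme \<Rightarrow> nat \<Rightarrow> nat \<Rightarrow> nat \<Rightarrow> 'a \<Rightarrow> 'a \<Rightarrow>
    (nat \<Rightarrow> 'a) \<times> (nat \<Rightarrow> nat)" where
  "eps2 M n i j a b =
     (\<lambda>k\<in>{1..n}. if k = i then a else if k = j then b else \<one>\<^bsub>M\<^esub>, eps n i j)"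

definition eps1 :: "('a, 'b) monoid_scheme \<Rightarrow> nat \<Rightarrow> nat \<Rightarrow> nat \<Rightarrow> 'a \<Rightarrow>
    (nat \<Rightarrow> 'a) \<times> (nat \<Rightarrow> nat)" where
  "eps1 M n i j a = eps2 M n i j \<one>\<^bsub>M\<^esub> a"

text \<open>In the names \<open>Xn\<close>, \<open>X2\<close>, \<open>X1\<close> the suffix stands for the subscript of \<open>\<X>\<close>.\<close>

definition Xn :: "('a, 'b) monoid_scheme \<Rightarrow> nat \<Rightarrow> ((nat \<Rightarrow> 'a) \<times> (nat \<Rightarrow> nat)) set" where
  "Xn M n = {(a, eps n i j) | i j a.
     i \<in> {1..n} \<and> j \<in> {1..n} \<and> i \<noteq> j \<and> a \<in> tuples M n}"

definition X2 :: "('a, 'b) monoid_scheme \<Rightarrow> nat \<Rightarrow> ((nat \<Rightarrow> 'a) \<times> (nat \<Rightarrow> nat)) set" where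
  "X2 M n = {eps2 M n i j a b | i j a b.
     i \<in> {1..n} \<and> j \<in> {1..n} \<and> i \<noteq> j \<and> a \<in> carrier M \<and> b \<in> carrier M}"

definition X1 :: "('a, 'b) monoid_scheme \<Rightarrow> nat \<Rightarrow> ((nat \<Rightarrow> 'a) \<times> (nat \<Rightarrow> nat)) set" where
  "X1 M n = {eps1 M n i j a | i j a.
     i \<in> {1..n} \<and> j \<in> {1..n} \<and> i \<noteq> j \<and> a \<in> carrier M}"


text \<open>Here \<open>carrier M #>\<^bsub>M\<^esub> b\<close> is the principal left ideal \<open>Mb\<close>.\<close>

definition L_le :: "('a, 'b) monoid_scheme \<Rightarrow> ('a \<times> 'a) set" where
  "L_le M = {(a, b). a \<in> carrier M \<and> b \<in> carrier M \<and> a \<in> carrier M #>\<^bsub>M\<^esub> b}"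

definition L_rel :: "('a, 'b) monoid_scheme \<Rightarrow> ('a \<times> 'a) set" where
  "L_rel M = L_le M \<inter> (L_le M)\<inverse>"

definition L_classes :: "('a, 'b) monoid_scheme \<Rightarrow> 'a set set" where
  "L_classes M = carrier M // L_rel M"

definition L_class_le :: "('a, 'b) monoid_scheme \<Rightarrow> ('a set \<times> 'a set) set" where
  "L_class_le M = {(A, B). A \<in> L_classes M \<and> B \<in> L_classes M \<and>
     (\<exists>a\<in>A. \<exists>b\<in>B. (a, b) \<in> L_le M)}"

end

theory Submission
  imports Defs
begin

text \<open>
  View \<open>(a, \<alpha>)\<close> as \<open>n\<close> registers, the \<open>k\<close>th one holding the element \<open>a\<^sub>k e\<^bsub>k\<alpha>\<^esub>\<close> of the free left
  \<open>M\<close>-act on \<open>e\<^sub>1, \<dots>, e\<^sub>n\<close>.  Left multiplication by \<open>\<epsilon>\<^bsub>ij;b\<^esub>\<close> is the assignment that overwrites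
  register \<open>j\<close> with \<open>b\<close> times register \<open>i\<close>.  If \<open>a\<^sub>i = m a\<^sub>j\<close> and \<open>i\<alpha> = j\<alpha>\<close>, then register \<open>i\<close> can be
  filled last, from register \<open>j\<close>, and so serves as scratch space while the other registers are
  filled one by one; hence \<open>(a, \<alpha>)\<close> is a product of elements of \<open>\<X>\<^sub>1\<close>.  For \<open>\<X>\<^sub>2\<close> one first
  produces the tuple with entries \<open>1\<close> in places \<open>i\<close> and \<open>j\<close>, and then scales both at once.
  The condition defining the right-hand side of (ii) survives right multiplication and is satisfied
  by every idempotent.
\<close>

section \<open>Generated subsemigroups and singular maps\<close>

lemma generated_subsemigroup_minimal:
  assumes "A \<subseteq> B" and "\<And>x y. x \<in> B \<Longrightarrow> y \<in> B \<Longrightarrow> f x y \<in> B"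
  shows "generated_subsemigroup f A \<subseteq> B"
proof
  fix x assume "x \<in> generated_subsemigroup f A"
  then show "x \<in> B"
    by induction (use assms in auto)
qed

lemma generated_subsemigroup_mono:
  "A \<subseteq> B \<Longrightarrow> generated_subsemigroup f A \<subseteq> generated_subsemigroup f B"
  by (rule generated_subsemigroup_minimal) (auto intro: generated_subsemigroup.intros)

lemma map_ker_iff: "(i, j) \<in> map_ker n \<alpha> \<longleftrightarrow> i \<in> {1..n} \<and> j \<in> {1..n} \<and> \<alpha> i = \<alpha> j"
  by (simp add: map_ker_def)

text \<open>An injective self-map of a finite set is surjective, so bijectivity can fail only by
  identifying two distinct points.\<close>

lemma Sing_iff:
  "\<alpha> \<in> Sing n \<longleftrightarrow> \<alpha> \<in> {1..n} \<rightarrow>\<^sub>E {1..n} \<and> (\<exists>i\<in>{1..n}. \<exists>j\<in>{1..n}. i \<noteq> j \<and> \<alpha> i = \<alpha> j)"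
proof (cases "\<alpha> \<in> {1..n} \<rightarrow>\<^sub>E {1..n}")
  case True
  then have "\<alpha> ` {1..n} \<subseteq> {1..n}" by auto
  then have "bij_betw \<alpha> {1..n} {1..n} \<longleftrightarrow> inj_on \<alpha> {1..n}"
    unfolding bij_betw_def using endo_inj_surj by blast
  with True show ?thesis
    by (auto simp: Sing_def full_transformations_def inj_on_def)
qed (simp add: Sing_def full_transformations_def)

lemma eps_in_Sing:
  assumes "i \<in> {1..n}" "j \<in> {1..n}" "i \<noteq> j"
  shows "eps n i j \<in> Sing n"
proof -
  have "eps n i j i = eps n i j j" using assms by (simp add: eps_def)
  then show ?thesis unfolding Sing_iff using assms by (auto simp: eps_def)
qed

lemma compose_in_Sing:
  assumes "\<alpha> \<in> Sing n" "\<beta> \<in> Sing n"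
  shows "compose {1..n} \<beta> \<alpha> \<in> Sing n"
proof -
  obtain i j where "i \<in> {1..n}" "j \<in> {1..n}" "i \<noteq> j" "\<alpha> i = \<alpha> j"
    using assms(1) unfolding Sing_iff by blast
  moreover from this have "compose {1..n} \<beta> \<alpha> i = compose {1..n} \<beta> \<alpha> j"
    by (simp add: compose_def)
  moreover have "compose {1..n} \<beta> \<alpha> \<in> {1..n} \<rightarrow>\<^sub>E {1..n}"
    using assms by (auto simp: Sing_iff compose_def PiE_iff)
  ultimately show ?thesis unfolding Sing_iff by blast
qed

context monoid
begin

section \<open>The preorder \<open>L_le\<close> and the poset of its classes\<close>

lemma L_le_iff:
  "(a, b) \<in> L_le G \<longleftrightarrow> b \<in> carrier G \<and> (\<exists>m\<in>carrier G. a = m \<otimes> b)"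
  by (auto simp: L_le_def r_coset_def)

lemma L_le_refl: "a \<in> carrier G \<Longrightarrow> (a, a) \<in> L_le G"
  unfolding L_le_iff by (metis l_one one_closed)

lemma L_le_trans: "(a, b) \<in> L_le G \<Longrightarrow> (b, c) \<in> L_le G \<Longrightarrow> (a, c) \<in> L_le G"
  unfolding L_le_iff by (metis m_assoc m_closed)

lemma L_le_mult_right:
  "(a, b) \<in> L_le G \<Longrightarrow> c \<in> carrier G \<Longrightarrow> (a \<otimes> c, b \<otimes> c) \<in> L_le G"
  unfolding L_le_iff by (metis m_assoc m_closed)

lemma equiv_L_rel: "equiv (carrier G) (L_rel G)"
proof (rule equivI)
  show "L_rel G \<subseteq> carrier G \<times> carrier G" by (auto simp: L_rel_def L_le_def)
  show "refl_on (carrier G) (L_rel G)"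
    by (auto simp: L_rel_def refl_on_def L_le_refl)
  show "sym (L_rel G)" by (auto simp: L_rel_def sym_def)
  show "trans (L_rel G)" by (auto simp: L_rel_def trans_def intro: L_le_trans)
qed

lemma L_classes_image: "L_classes G = (\<lambda>a. L_rel G `` {a}) ` carrier G"
  by (auto simp: L_classes_def quotient_def)

lemma L_classes_iff: "A \<in> L_classes G \<longleftrightarrow> (\<exists>a\<in>carrier G. A = L_rel G `` {a})"
  by (auto simp: L_classes_def quotient_def)

text \<open>Representatives may be exchanged within their classes because \<open>L_rel\<close> lies
  in \<open>L_le\<close> in both directions; questions about classes thus become questions about
  elements.\<close>

lemma L_class_le_iff:
  assumes "a \<in> carrier G" "b \<in> carrier G"
  shows "(L_rel G `` {a}, L_rel G `` {b}) \<in> L_class_le G \<longleftrightarrow> (a, b) \<in> L_le G"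
proof
  assume "(L_rel G `` {a}, L_rel G `` {b}) \<in> L_class_le G"
  then show "(a, b) \<in> L_le G"
    by (auto simp: L_class_le_def L_rel_def intro: L_le_trans)
next
  assume "(a, b) \<in> L_le G"
  with assms show "(L_rel G `` {a}, L_rel G `` {b}) \<in> L_class_le G"
    by (force simp: L_class_le_def L_classes_iff L_rel_def intro: L_le_refl)
qed

text \<open>The classes of a preorder always form a poset, so only totality depends on the monoid.
  Totality concerns distinct classes, but representatives of equal classes are comparable
  anyway.\<close>

lemma linear_order_L_class_le_iff:
  "linear_order_on (L_classes G) (L_class_le G) \<longleftrightarrow>
     (\<forall>a\<in>carrier G. \<forall>b\<in>carrier G. (a, b) \<in> L_le G \<or> (b, a) \<in> L_le G)"
proof -
  have eq: "L_rel G `` {a} = L_rel G `` {b} \<longleftrightarrow> (a, b) \<in> L_le G \<and> (b, a) \<in> L_le G"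
    if "a \<in> carrier G" "b \<in> carrier G" for a b
    using eq_equiv_class_iff[OF equiv_L_rel that] by (auto simp: L_rel_def)
  have cl: "(A, B) \<in> L_class_le G \<Longrightarrow> A \<in> L_classes G \<and> B \<in> L_classes G" for A B
    by (simp add: L_class_le_def)
  have "refl_on (L_classes G) (L_class_le G)"
    by (auto simp: refl_on_def L_classes_iff L_class_le_iff L_le_refl)
  moreover have "trans (L_class_le G)"
  proof (rule transI)
    fix A B C assume *: "(A, B) \<in> L_class_le G" "(B, C) \<in> L_class_le G"
    with cl obtain a b c where "a \<in> carrier G" "b \<in> carrier G" "c \<in> carrier G"
      "A = L_rel G `` {a}" "B = L_rel G `` {b}" "C = L_rel G `` {c}"
      unfolding L_classes_iff by metis
    with * show "(A, C) \<in> L_class_le G"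
      by (auto simp: L_class_le_iff intro: L_le_trans)
  qed
  moreover have "antisym (L_class_le G)"
  proof (rule antisymI)
    fix A B assume *: "(A, B) \<in> L_class_le G" "(B, A) \<in> L_class_le G"
    with cl obtain a b where "a \<in> carrier G" "b \<in> carrier G"
      "A = L_rel G `` {a}" "B = L_rel G `` {b}"
      unfolding L_classes_iff by metis
    with * show "A = B" by (simp add: L_class_le_iff eq)
  qed
  moreover have "L_class_le G \<subseteq> L_classes G \<times> L_classes G" using cl by auto
  moreover have "total_on (L_classes G) (L_class_le G) \<longleftrightarrow>
      (\<forall>a\<in>carrier G. \<forall>b\<in>carrier G. (a, b) \<in> L_le G \<or> (b, a) \<in> L_le G)"
    unfolding total_on_def L_classes_image by (simp add: L_class_le_iff eq) blast
  ultimately show ?thesis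
    by (simp add: linear_order_on_def partial_order_on_def preorder_on_def)
qed

section \<open>Left multiplication by generators as assignment to registers\<close>

definition wreath_one :: "nat \<Rightarrow> (nat \<Rightarrow> 'a) \<times> (nat \<Rightarrow> nat)" where
  "wreath_one n = (\<lambda>k\<in>{1..n}. \<one>, \<lambda>k\<in>{1..n}. k)"

definition assign :: "nat \<Rightarrow> nat \<Rightarrow> 'a \<Rightarrow> (nat \<Rightarrow> 'a) \<times> (nat \<Rightarrow> nat) \<Rightarrow> (nat \<Rightarrow> 'a) \<times> (nat \<Rightarrow> nat)"
  where "assign i j b = (\<lambda>(a, \<alpha>). (a(j := b \<otimes> a i), \<alpha>(j := \<alpha> i)))"

text \<open>Both \<open>i\<close> and \<open>j\<close> are sent to \<open>i\<close> by
  \<open>eps n i j\<close>, so both new entries read the old \<open>a i\<close>; every other place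
  is multiplied by \<open>\<one>\<close>.\<close>

lemma eps2_mult:
  assumes "i \<in> {1..n}" "j \<in> {1..n}" "i \<noteq> j" "a \<in> tuples G n" "\<alpha> \<in> full_transformations n"
    and "b \<in> carrier G" "c \<in> carrier G"
  shows "wreath_mult G n (eps2 G n i j b c) (a, \<alpha>) = (a(i := b \<otimes> a i, j := c \<otimes> a i), \<alpha>(j := \<alpha> i))"
  using assms
  by (auto simp: wreath_mult_def eps2_def eps_def compose_def tuples_def full_transformations_def
      fun_eq_iff PiE_iff extensional_def)

lemma eps1_mult:
  assumes "i \<in> {1..n}" "j \<in> {1..n}" "i \<noteq> j" "x \<in> tuples G n \<times> full_transformations n"
    and "b \<in> carrier G"
  shows "wreath_mult G n (eps1 G n i j b) x = assign i j b x"
proof -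
  obtain a \<alpha> where x: "x = (a, \<alpha>)" "a \<in> tuples G n" "\<alpha> \<in> full_transformations n"
    using assms(4) by auto
  then have "a i \<in> carrier G" using assms(1) by (auto simp: tuples_def)
  with x show ?thesis
    using assms by (simp add: eps1_def eps2_mult assign_def)
qed

text \<open>This makes a product of generators a program of assignments run from the identity
  state.\<close>

lemma eps1_eq_assign:
  assumes "i \<in> {1..n}" "j \<in> {1..n}" "i \<noteq> j" "b \<in> carrier G"
  shows "eps1 G n i j b = assign i j b (wreath_one n)"
  using assms by (auto simp: eps1_def eps2_def eps_def assign_def wreath_one_def fun_eq_iff)

text \<open>
  \<open>U\<close> is the set of registers still to be filled and register \<open>i\<close> is scratch; \<open>\<sigma> u\<close> is the place
  where the value required by \<open>u\<close> currently sits.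
\<close>

lemma parallel_assignment:
  assumes closed: "\<And>p q b x. p \<in> {1..n} \<Longrightarrow> q \<in> {1..n} \<Longrightarrow> p \<noteq> q \<Longrightarrow> b \<in> carrier G \<Longrightarrow>
      x \<in> K \<Longrightarrow> assign p q b x \<in> K"
    and sub: "K \<subseteq> tuples G n \<times> full_transformations n"
    and i: "i \<in> {1..n}"
    and "finite U" "U \<subseteq> {1..n} - {i}" "\<sigma> ` U \<subseteq> insert i U" "c ` U \<subseteq> carrier G" "(a, \<alpha>) \<in> K"
  shows "\<exists>a' \<alpha>'. (a', \<alpha>') \<in> K \<and> (\<forall>u\<in>U. a' u = c u \<otimes> a (\<sigma> u) \<and> \<alpha>' u = \<alpha> (\<sigma> u)) \<and>
      (\<forall>k. k \<notin> insert i U \<longrightarrow> a' k = a k \<and> \<alpha>' k = \<alpha> k)"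
  using assms(4-)
\<comment> \<open>State and source map both vary: each filling changes the state, and saving a
  register in the scratch place redirects sources.\<close>
proof (induction "card U" arbitrary: U \<sigma> a \<alpha>)
  case 0
  then show ?case by auto
next
  case (Suc N)
  text \<open>A register whose content nobody needs can be filled right away.\<close>
  have step: "\<exists>a' \<alpha>'. (a', \<alpha>') \<in> K \<and> (\<forall>u\<in>U. a' u = c u \<otimes> a (\<sigma> u) \<and> \<alpha>' u = \<alpha> (\<sigma> u)) \<and>
      (\<forall>k. k \<notin> insert i U \<longrightarrow> a' k = a k \<and> \<alpha>' k = \<alpha> k)"
    if u: "u \<in> U" "u \<notin> \<sigma> ` U" and \<sigma>: "\<sigma> ` U \<subseteq> insert i U" and K: "(a, \<alpha>) \<in> K" for u \<sigma> a \<alpha>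
  proof -
    have "\<sigma> u \<in> insert i U" using u \<sigma> by blast
    moreover have "insert i U \<subseteq> {1..n}" using Suc.prems(2) i by auto
    ultimately have "\<sigma> u \<in> {1..n}" "u \<in> {1..n}" using u(1) by auto
    moreover have "\<sigma> u \<noteq> u" using u by (metis imageI)
    moreover have "c u \<in> carrier G" using u(1) Suc.prems(4) by auto
    ultimately have closed_u: "assign (\<sigma> u) u (c u) (a, \<alpha>) \<in> K" using closed K by blast
    from closed_u have K': "(a(u := c u \<otimes> a (\<sigma> u)), \<alpha>(u := \<alpha> (\<sigma> u))) \<in> K"
      by (simp add: assign_def)
    have U': "N = card (U - {u})" "finite (U - {u})" "U - {u} \<subseteq> {1..n} - {i}"
      "\<sigma> ` (U - {u}) \<subseteq> insert i (U - {u})" "c ` (U - {u}) \<subseteq> carrier G"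
      using Suc.hyps(2) Suc.prems(1,2,4) u \<sigma> by (simp, simp, blast, blast, blast)
    obtain a' \<alpha>' where
      K'': "(a', \<alpha>') \<in> K" and
      fill: "\<forall>v\<in>U - {u}. a' v = c v \<otimes> (a(u := c u \<otimes> a (\<sigma> u))) (\<sigma> v) \<and>
        \<alpha>' v = (\<alpha>(u := \<alpha> (\<sigma> u))) (\<sigma> v)" and
      keep: "\<forall>k. k \<notin> insert i (U - {u}) \<longrightarrow>
        a' k = (a(u := c u \<otimes> a (\<sigma> u))) k \<and> \<alpha>' k = (\<alpha>(u := \<alpha> (\<sigma> u))) k"
      using Suc.hyps(1)[OF U' K'] by (elim exE conjE) (rule that)
    have "u \<noteq> i" using u Suc.prems by auto
    have "a' v = c v \<otimes> a (\<sigma> v) \<and> \<alpha>' v = \<alpha> (\<sigma> v)" if "v \<in> U" for v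
    proof (cases "v = u")
      case True
      then show ?thesis using keep \<open>u \<noteq> i\<close> by simp
    next
      case False
      moreover have "\<sigma> v \<noteq> u" using u that by auto
      ultimately show ?thesis using fill that by simp
    qed
    moreover have "a' k = a k \<and> \<alpha>' k = \<alpha> k" if "k \<notin> insert i U" for k
      using keep that u by auto
    ultimately show ?thesis using K'' by (intro exI[of _ a'] exI[of _ \<alpha>'] conjI ballI allI impI) simp_all
  qed
  show ?case
  proof (cases "i \<in> \<sigma> ` U")
    case True
    \<comment> \<open>Counting: an image of \<open>U\<close> containing \<open>U\<close> and also
      \<open>i\<close>, which is not in \<open>U\<close>, would have more elements than
      \<open>U\<close>.\<close>
    have "\<not> U \<subseteq> \<sigma> ` U"
    proof
      assume "U \<subseteq> \<sigma> ` U"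
      with True have "card (insert i U) \<le> card (\<sigma> ` U)"
        using Suc.prems by (intro card_mono) auto
      also have "\<dots> \<le> card U" using Suc.prems by (simp add: card_image_le)
      finally show False using Suc.prems by (subst (asm) card_insert_disjoint) auto
    qed
    then obtain u where "u \<in> U" "u \<notin> \<sigma> ` U" by blast
    then show ?thesis using Suc.prems(3,5) by (rule step)
  next
    case False
    text \<open>Move the content of an arbitrary \<open>u\<close> to the scratch register.\<close>
    have "U \<noteq> {}" using Suc.hyps(2) by auto
    then obtain u where u: "u \<in> U" by blast
    have ui: "u \<in> {1..n}" "u \<noteq> i" using u Suc.prems by auto
    have "a \<in> tuples G n" using sub Suc.prems(5) by blast
    then have "a u \<in> carrier G" using ui(1) by (auto simp: tuples_def)
    then have au: "\<one> \<otimes> a u = a u" by simp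
    have K': "(a(i := a u), \<alpha>(i := \<alpha> u)) \<in> K"
      using closed[OF ui(1) i ui(2) one_closed Suc.prems(5)] au by (simp add: assign_def)
    \<comment> \<open>Readers of \<open>u\<close> are redirected to its copy in \<open>i\<close>,
      which frees \<open>u\<close>. No \<open>\<sigma> v\<close> is \<open>i\<close> in this case,
      so overwriting \<open>i\<close> loses nothing.\<close>
    define \<tau> where "\<tau> = (\<lambda>k. if \<sigma> k = u then i else \<sigma> k)"
    have "u \<notin> \<tau> ` U" "\<tau> ` U \<subseteq> insert i U"
      using Suc.prems(3) ui by (auto simp: \<tau>_def)
    from step[OF u this K'] obtain a' \<alpha>' where
      "(a', \<alpha>') \<in> K" and
      fill: "\<forall>v\<in>U. a' v = c v \<otimes> (a(i := a u)) (\<tau> v) \<and> \<alpha>' v = (\<alpha>(i := \<alpha> u)) (\<tau> v)" and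
      keep: "\<forall>k. k \<notin> insert i U \<longrightarrow> a' k = (a(i := a u)) k \<and> \<alpha>' k = (\<alpha>(i := \<alpha> u)) k"
      by (elim exE conjE) (rule that)
    moreover have "(a(i := a u)) (\<tau> v) = a (\<sigma> v)" "(\<alpha>(i := \<alpha> u)) (\<tau> v) = \<alpha> (\<sigma> v)"
      if "v \<in> U" for v
      using that False by (auto simp: \<tau>_def)
    ultimately show ?thesis by (intro exI[of _ a'] exI[of _ \<alpha>']) simp
  qed
qed

section \<open>The wreath product and its generating sets\<close>

lemma wreath_mult_closed:
  assumes "x \<in> wreath G n (Sing n)" "y \<in> wreath G n (Sing n)"
  shows "wreath_mult G n x y \<in> wreath G n (Sing n)"
proof -
  obtain a \<alpha> b \<beta> where x: "x = (a, \<alpha>)" and y: "y = (b, \<beta>)" by fastforce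
  have "a \<in> tuples G n" "b \<in> tuples G n" "\<alpha> \<in> Sing n" "\<beta> \<in> Sing n"
    using assms by (auto simp: x y wreath_def)
  moreover from this have "(\<lambda>i\<in>{1..n}. a i \<otimes> b (\<alpha> i)) \<in> tuples G n"
    by (auto simp: tuples_def Sing_iff PiE_iff)
  ultimately show ?thesis
    by (simp add: x y wreath_def wreath_mult_def compose_in_Sing del: One_nat_def)
qed

lemma X1_subset_X2: "X1 G n \<subseteq> X2 G n"
  unfolding X1_def X2_def eps1_def by blast

lemma X2_subset_Xn: "X2 G n \<subseteq> Xn G n"
proof
  fix x assume "x \<in> X2 G n"
  then obtain i j a b where "x = eps2 G n i j a b" "i \<in> {1..n}" "j \<in> {1..n}" "i \<noteq> j"
    "a \<in> carrier G" "b \<in> carrier G" unfolding X2_def by blast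
  moreover from this have
    "(\<lambda>k\<in>{1..n}. if k = i then a else if k = j then b else \<one>) \<in> tuples G n"
    by (auto simp: tuples_def)
  ultimately show "x \<in> Xn G n" by (auto simp: Xn_def eps2_def simp del: One_nat_def)
qed

lemma Xn_subset_wreath: "Xn G n \<subseteq> wreath G n (Sing n)"
  by (auto simp: Xn_def wreath_def eps_in_Sing)

text \<open>After the assignment register \<open>j\<close> already holds \<open>b\<close> times the
  untouched register \<open>i\<close>, so repeating it changes nothing.\<close>

lemma X1_subset_idempotents:
  "X1 G n \<subseteq> idempotents (wreath_mult G n) (wreath G n (Sing n))"
proof
  fix x assume x: "x \<in> X1 G n"
  then obtain i j b where *: "i \<in> {1..n}" "j \<in> {1..n}" "i \<noteq> j" "b \<in> carrier G"
    and xeq: "x = eps1 G n i j b" unfolding X1_def by blast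
  have w: "x \<in> wreath G n (Sing n)"
    using x X1_subset_X2 X2_subset_Xn Xn_subset_wreath by blast
  then have "x \<in> tuples G n \<times> full_transformations n" by (auto simp: wreath_def Sing_def)
  from eps1_mult[OF *(1-3) this *(4)] have "wreath_mult G n x x = assign i j b x"
    by (simp only: xeq)
  also have "\<dots> = x"
    using * by (auto simp: xeq eps1_def eps2_def eps_def assign_def fun_eq_iff)
  finally show "x \<in> idempotents (wreath_mult G n) (wreath G n (Sing n))"
    using w by (simp add: idempotents_def)
qed

section \<open>The comparability condition on kernel pairs\<close>

definition L_comparable_set :: "nat \<Rightarrow> ((nat \<Rightarrow> 'a) \<times> (nat \<Rightarrow> nat)) set" where
  "L_comparable_set n = {(a, \<alpha>) \<in> wreath G n (Sing n).
     \<exists>(i, j) \<in> map_ker n \<alpha> - Id_on {1..n}. (a i, a j) \<in> L_le G}"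

lemma L_comparable_set_iff:
  "(a, \<alpha>) \<in> L_comparable_set n \<longleftrightarrow> (a, \<alpha>) \<in> wreath G n (Sing n) \<and>
     (\<exists>i\<in>{1..n}. \<exists>j\<in>{1..n}. i \<noteq> j \<and> \<alpha> i = \<alpha> j \<and> (a i, a j) \<in> L_le G)"
  unfolding L_comparable_set_def Bex_def split_paired_Ex
  by (simp add: map_ker_iff Id_on_iff del: atLeastAtMost_iff One_nat_def) metis

text \<open>A kernel pair of \<open>\<alpha>\<close> remains one for the product, and both its
  entries are multiplied on the right by the same element, which preserves
  \<open>L_le\<close>.\<close>

lemma L_comparable_set_mult_right:
  assumes "x \<in> L_comparable_set n" "y \<in> wreath G n (Sing n)"
  shows "wreath_mult G n x y \<in> L_comparable_set n"
proof -
  obtain a \<alpha> b \<beta> where x: "x = (a, \<alpha>)" and y: "y = (b, \<beta>)" by fastforce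
  have xw: "x \<in> wreath G n (Sing n)" using assms(1) by (auto simp: x L_comparable_set_iff)
  obtain i j where ij: "i \<in> {1..n}" "j \<in> {1..n}" "i \<noteq> j" "\<alpha> i = \<alpha> j" "(a i, a j) \<in> L_le G"
    using assms(1) by (auto simp: x L_comparable_set_iff)
  have "b (\<alpha> j) \<in> carrier G"
    using ij xw assms(2) by (auto simp: x y wreath_def tuples_def Sing_iff PiE_iff)
  then have "(a i \<otimes> b (\<alpha> i), a j \<otimes> b (\<alpha> j)) \<in> L_le G"
    using ij L_le_mult_right by simp
  moreover have "wreath_mult G n x y \<in> wreath G n (Sing n)"
    using wreath_mult_closed xw assms(2) .
  ultimately show ?thesis using ij
    unfolding x y wreath_mult_def prod.case L_comparable_set_iff
    by (intro conjI bexI[of _ i] bexI[of _ j]) (simp_all add: compose_def)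
qed

text \<open>A singular map moves some \<open>k\<close>. Idempotency makes \<open>k\<close> and
  \<open>\<alpha> k\<close> a kernel pair, and coordinate \<open>k\<close> reads
  \<open>a k \<otimes> a (\<alpha> k) = a k\<close>, whence \<open>a k\<close> is a left multiple of
  \<open>a (\<alpha> k)\<close>.\<close>

lemma idempotents_subset_L_comparable_set:
  "idempotents (wreath_mult G n) (wreath G n (Sing n)) \<subseteq> L_comparable_set n"
proof
  fix x assume x: "x \<in> idempotents (wreath_mult G n) (wreath G n (Sing n))"
  obtain a \<alpha> where xeq: "x = (a, \<alpha>)" by fastforce
  have w: "x \<in> wreath G n (Sing n)" and idem: "wreath_mult G n x x = x"
    using x by (auto simp: idempotents_def)
  have \<alpha>: "\<alpha> \<in> Sing n" and a: "a \<in> tuples G n" using w by (auto simp: xeq wreath_def)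
  have "\<not> (\<forall>k\<in>{1..n}. \<alpha> k = k)" using \<alpha> unfolding Sing_iff by metis
  then obtain k where k: "k \<in> {1..n}" "\<alpha> k \<noteq> k" by blast
  then have \<alpha>k: "\<alpha> k \<in> {1..n}" using \<alpha> by (auto simp: Sing_iff)
  have "a k \<otimes> a (\<alpha> k) = a k" "\<alpha> (\<alpha> k) = \<alpha> k"
    using idem k by (auto simp: xeq wreath_mult_def compose_def fun_eq_iff split: if_splits)
  moreover have "a k \<in> carrier G" "a (\<alpha> k) \<in> carrier G"
    using a k \<alpha>k by (auto simp: tuples_def)
  ultimately have "(a k, a (\<alpha> k)) \<in> L_le G" "\<alpha> k = \<alpha> (\<alpha> k)"
    unfolding L_le_iff by metis+
  then show "x \<in> L_comparable_set n"
    using w k \<alpha>k unfolding xeq L_comparable_set_iff by metis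
qed

section \<open>Factorisation into generators\<close>

lemma L_comparable_set_subset_generated_X1:
  "L_comparable_set n \<subseteq> generated_subsemigroup (wreath_mult G n) (X1 G n)"
proof
  fix x assume x: "x \<in> L_comparable_set n"
  obtain a \<alpha> where xeq: "x = (a, \<alpha>)" by fastforce
  obtain i j where ij: "i \<in> {1..n}" "j \<in> {1..n}" "i \<noteq> j" "\<alpha> i = \<alpha> j" "(a i, a j) \<in> L_le G"
    using x by (auto simp: xeq L_comparable_set_iff)
  obtain m where m: "m \<in> carrier G" "a i = m \<otimes> a j" using ij by (auto simp: L_le_iff)
  have \<alpha>: "\<alpha> \<in> {1..n} \<rightarrow>\<^sub>E {1..n}" and a: "a \<in> {1..n} \<rightarrow>\<^sub>E carrier G"
    using x by (auto simp: xeq L_comparable_set_iff wreath_def tuples_def Sing_iff)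
  let ?S = "generated_subsemigroup (wreath_mult G n) (X1 G n)"
  \<comment> \<open>The identity is not singular; it is adjoined only as the initial state. Any
    single assignment leads from \<open>?K\<close> into \<open>?S\<close>.\<close>
  let ?K = "insert (wreath_one n) ?S"
  have S: "?S \<subseteq> wreath G n (Sing n)"
    using X1_subset_X2 X2_subset_Xn Xn_subset_wreath
    by (intro generated_subsemigroup_minimal wreath_mult_closed) blast+
  then have K: "?K \<subseteq> tuples G n \<times> full_transformations n"
    by (auto simp: wreath_def Sing_def wreath_one_def tuples_def full_transformations_def)
  have op: "assign p q b y \<in> ?S"
    if "p \<in> {1..n}" "q \<in> {1..n}" "p \<noteq> q" "b \<in> carrier G" "y \<in> ?K" for p q b y
  proof -
    have g: "eps1 G n p q b \<in> ?S"
      using that by (auto simp: X1_def intro!: generated_subsemigroup.incl)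
    show ?thesis
    proof (cases "y = wreath_one n")
      case True
      then show ?thesis using g eps1_eq_assign that by simp
    next
      case False
      then have "y \<in> ?S" using that by simp
      then have "wreath_mult G n (eps1 G n p q b) y \<in> ?S"
        by (rule generated_subsemigroup.prod[OF g])
      then show ?thesis using eps1_mult[OF that(1-3) subsetD[OF K that(5)] that(4)] by simp
    qed
  qed
  \<comment> \<open>Initially register \<open>k\<close> holds the \<open>k\<close>th free generator,
    so the source map is \<open>\<alpha>\<close> and the coefficients are those of
    \<open>a\<close>.\<close>
  have "\<exists>a' \<alpha>'. (a', \<alpha>') \<in> ?K \<and>
      (\<forall>u\<in>{1..n} - {i}. a' u = a u \<otimes> (\<lambda>k\<in>{1..n}. \<one>) (\<alpha> u) \<and> \<alpha>' u = (\<lambda>k\<in>{1..n}. k) (\<alpha> u)) \<and>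
      (\<forall>k. k \<notin> insert i ({1..n} - {i}) \<longrightarrow>
         a' k = (\<lambda>k\<in>{1..n}. \<one>) k \<and> \<alpha>' k = (\<lambda>k\<in>{1..n}. k) k)"
    by (rule parallel_assignment[OF _ K ij(1)])
      (use op a \<alpha> ij(1) in \<open>auto simp: wreath_one_def PiE_iff\<close>)
  then obtain a' \<alpha>' where K': "(a', \<alpha>') \<in> ?K" and
    fill: "\<forall>u\<in>{1..n} - {i}. a' u = a u \<otimes> (\<lambda>k\<in>{1..n}. \<one>) (\<alpha> u) \<and> \<alpha>' u = (\<lambda>k\<in>{1..n}. k) (\<alpha> u)"
    by blast
  have fill': "a' u = a u" "\<alpha>' u = \<alpha> u" if "u \<in> {1..n}" "u \<noteq> i" for u
  proof -
    have "\<alpha> u \<in> {1..n}" "a u \<in> carrier G" using that a \<alpha> by auto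
    then show "a' u = a u" "\<alpha>' u = \<alpha> u" using fill that by auto
  qed
  \<comment> \<open>Equality of functions also concerns arguments outside \<open>{1..n}\<close>,
    where all four take the default value.\<close>
  have ext: "a' u = undefined" "\<alpha>' u = undefined" "a u = undefined" "\<alpha> u = undefined"
    if "u \<notin> {1..n}" for u
    using that K' K a \<alpha> by (auto simp: tuples_def full_transformations_def PiE_iff extensional_def)
  have "a'(i := m \<otimes> a' j) = a"
  proof
    show "(a'(i := m \<otimes> a' j)) u = a u" for u
      using fill' ext ij m by (cases "u = i"; cases "u \<in> {1..n}") auto
  qed
  moreover have "\<alpha>'(i := \<alpha>' j) = \<alpha>"
  proof
    show "(\<alpha>'(i := \<alpha>' j)) u = \<alpha> u" for u
      using fill' ext ij by (cases "u = i"; cases "u \<in> {1..n}") auto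
  qed
  \<comment> \<open>The closing assignment from \<open>j\<close> to the scratch register
    \<open>i\<close> also ensures membership in \<open>?S\<close> rather than just
    \<open>?K\<close>.\<close>
  ultimately show "x \<in> ?S"
    using op[OF ij(2,1) _ m(1) K'] ij(3) by (simp add: xeq assign_def)
qed

lemma wreath_subset_generated_X2:
  "wreath G n (Sing n) \<subseteq> generated_subsemigroup (wreath_mult G n) (X2 G n)"
proof
  fix x assume x: "x \<in> wreath G n (Sing n)"
  obtain a \<alpha> where xeq: "x = (a, \<alpha>)" by fastforce
  have \<alpha>: "\<alpha> \<in> Sing n" and a: "a \<in> tuples G n" using x by (auto simp: xeq wreath_def)
  obtain i j where ij: "i \<in> {1..n}" "j \<in> {1..n}" "i \<noteq> j" "\<alpha> i = \<alpha> j"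
    using \<alpha> unfolding Sing_iff by blast
  have aij: "a i \<in> carrier G" "a j \<in> carrier G" using a ij by (auto simp: tuples_def)
  \<comment> \<open>Equal entries make the kernel pair comparable by reflexivity.\<close>
  let ?b = "a(i := \<one>, j := \<one>)"
  have b: "?b \<in> tuples G n"
    using a ij by (auto simp: tuples_def PiE_iff extensional_def)
  have "(?b i, ?b j) \<in> L_le G" using ij L_le_refl by simp
  then have "(?b, \<alpha>) \<in> L_comparable_set n"
    using b \<alpha> ij unfolding L_comparable_set_iff wreath_def by blast
  then have "(?b, \<alpha>) \<in> generated_subsemigroup (wreath_mult G n) (X2 G n)"
    using L_comparable_set_subset_generated_X1 generated_subsemigroup_mono[OF X1_subset_X2] by blast
  moreover have "eps2 G n i j (a i) (a j) \<in> generated_subsemigroup (wreath_mult G n) (X2 G n)"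
    using ij aij by (intro generated_subsemigroup.incl) (auto simp: X2_def)
  \<comment> \<open>The entries scaled are \<open>\<one>\<close>, and
    \<open>\<alpha> i = \<alpha> j\<close> makes the update of \<open>\<alpha>\<close>
    vacuous.\<close>
  moreover have "wreath_mult G n (eps2 G n i j (a i) (a j)) (?b, \<alpha>) = x"
    using eps2_mult[OF ij(1-3) b _ aij] \<alpha> ij aij by (simp add: Sing_def xeq fun_eq_iff)
  ultimately show "x \<in> generated_subsemigroup (wreath_mult G n) (X2 G n)"
    using generated_subsemigroup.prod by metis
qed

section \<open>The chain condition and the three statements\<close>

lemma L_comparable_set_eq_wreath_iff:
  assumes "n \<ge> 2"
  shows "L_comparable_set n = wreath G n (Sing n) \<longleftrightarrow>
    (\<forall>a\<in>carrier G. \<forall>b\<in>carrier G. (a, b) \<in> L_le G \<or> (b, a) \<in> L_le G)"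
proof
  assume eq: "L_comparable_set n = wreath G n (Sing n)"
  show "\<forall>a\<in>carrier G. \<forall>b\<in>carrier G. (a, b) \<in> L_le G \<or> (b, a) \<in> L_le G"
  proof (intro ballI)
    fix a b assume ab: "a \<in> carrier G" "b \<in> carrier G"
    \<comment> \<open>The only nontrivial kernel pair of \<open>eps n 1 2\<close> is 1 and 2, in
      either order, and there the entries are \<open>a\<close> and \<open>b\<close>.\<close>
    have "eps2 G n 1 2 a b \<in> X2 G n"
      unfolding X2_def using ab assms by fastforce
    then have "eps2 G n 1 2 a b \<in> L_comparable_set n"
      using eq X2_subset_Xn Xn_subset_wreath by blast
    then obtain i j where "i \<in> {1..n}" "j \<in> {1..n}" "i \<noteq> j" "eps n 1 2 i = eps n 1 2 j"
      and le: "((\<lambda>k\<in>{1..n}. if k = 1 then a else if k = 2 then b else \<one>) i,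
        (\<lambda>k\<in>{1..n}. if k = 1 then a else if k = 2 then b else \<one>) j) \<in> L_le G"
      unfolding eps2_def L_comparable_set_iff by blast
    moreover from this have "i = 1 \<and> j = 2 \<or> i = 2 \<and> j = 1"
      by (auto simp: eps_def split: if_splits)
    ultimately show "(a, b) \<in> L_le G \<or> (b, a) \<in> L_le G" by auto
  qed
next
  assume tot: "\<forall>a\<in>carrier G. \<forall>b\<in>carrier G. (a, b) \<in> L_le G \<or> (b, a) \<in> L_le G"
  have "(a, \<alpha>) \<in> L_comparable_set n" if w: "(a, \<alpha>) \<in> wreath G n (Sing n)" for a \<alpha>
  proof -
    obtain i j where ij: "i \<in> {1..n}" "j \<in> {1..n}" "i \<noteq> j" "\<alpha> i = \<alpha> j"
      using w by (auto simp: wreath_def Sing_iff)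
    moreover have "a i \<in> carrier G" "a j \<in> carrier G"
      using w ij by (auto simp: wreath_def tuples_def)
    \<comment> \<open>The kernel is symmetric, so comparability in either direction
      suffices.\<close>
    ultimately show ?thesis using w tot unfolding L_comparable_set_iff by metis
  qed
  then show "L_comparable_set n = wreath G n (Sing n)"
    by (auto simp: L_comparable_set_iff)
qed

end

theorem theorem4p7:
  fixes M :: "('a, 'b) monoid_scheme" and n :: nat
  assumes "monoid M" and "n \<ge> 2"
  shows
    "(wreath M n (Sing n) = generated_subsemigroup (wreath_mult M n) (Xn M n) \<and>
      generated_subsemigroup (wreath_mult M n) (Xn M n) =
        generated_subsemigroup (wreath_mult M n) (X2 M n)) \<and>
     (generated_subsemigroup (wreath_mult M n)
          (idempotents (wreath_mult M n) (wreath M n (Sing n))) =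
        generated_subsemigroup (wreath_mult M n) (X1 M n) \<and>
      generated_subsemigroup (wreath_mult M n) (X1 M n) =
        {(a, \<alpha>) \<in> wreath M n (Sing n).
           \<exists>(i, j) \<in> map_ker n \<alpha> - Id_on {1..n}. (a i, a j) \<in> L_le M}) \<and>
     (idempotent_generated (wreath_mult M n) (wreath M n (Sing n)) \<longleftrightarrow>
        linear_order_on (L_classes M) (L_class_le M))"
proof -
  interpret monoid M by fact
  let ?gen = "generated_subsemigroup (wreath_mult M n)"
  let ?P = "wreath M n (Sing n)"
  let ?E = "idempotents (wreath_mult M n) ?P"
  have Xn: "?gen (Xn M n) \<subseteq> ?P"
    by (intro generated_subsemigroup_minimal Xn_subset_wreath wreath_mult_closed)
  \<comment> \<open>Inclusions close up: \<open>?gen (Xn M n)\<close> lies in \<open>?P\<close>,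
    which lies in \<open>?gen (X2 M n)\<close>, which lies in \<open>?gen (Xn M n)\<close>.\<close>
  have i: "?P = ?gen (Xn M n)" "?gen (Xn M n) = ?gen (X2 M n)"
    using Xn wreath_subset_generated_X2 generated_subsemigroup_mono[OF X2_subset_Xn] by blast+
  have "L_comparable_set n \<subseteq> ?P" by (auto simp: L_comparable_set_iff)
  then have "?gen ?E \<subseteq> L_comparable_set n"
    using idempotents_subset_L_comparable_set L_comparable_set_mult_right
    by (intro generated_subsemigroup_minimal) blast+
  \<comment> \<open>Again a cycle: from \<open>?gen ?E\<close> to \<open>L_comparable_set n\<close>,
    to \<open>?gen (X1 M n)\<close>, and back to \<open>?gen ?E\<close>.\<close>
  then have ii: "?gen ?E = ?gen (X1 M n)" "?gen (X1 M n) = L_comparable_set n"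
    using L_comparable_set_subset_generated_X1 generated_subsemigroup_mono[OF X1_subset_idempotents]
    by blast+
  have iii: "idempotent_generated (wreath_mult M n) ?P \<longleftrightarrow>
      linear_order_on (L_classes M) (L_class_le M)"
    unfolding idempotent_generated_def ii linear_order_L_class_le_iff
    using L_comparable_set_eq_wreath_iff[OF assms(2)] .
  show ?thesis
    using i ii iii unfolding L_comparable_set_def by blast
qed

end
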